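(* Let $(x_k)_{k\in\mathbb{N}}$ be distinct real numbers and let $p_{x_k}\geqslant 0$, $k\in\mathbb{N}$, satisfy $\sum_{k=1}^\infty p_{x_k}=1$. Let $F(x)=\sum_{k\in\mathbb{N}:\,x_k\leqslant x}p_{x_k}$, $x\in\mathbb{R}$, be the corresponding discrete distribution function, and let $f(t)=\sum_{k\in\mathbb{N}}p_{x_k}e^{itx_k}$, $t\in\mathbb{R}$, be its characteristic function. Suppose that $\inf_{t\in\mathbb{R}}|f(t)|=0$. Then $F$ is not quasi-infinitely divisible.
   Context: $\mathbb{N}$ denotes the set of positive integers. A distribution function $F$ on $\mathbb{R}$ with characteristic function $f$ is called quasi-infinitely divisible if $f$ admits the representation $$f(t)=\exp\Bigl\{it\gamma-\frac{\sigma^2t^2}{2}+\int_{\mathbb{R}\setminus\{0\}}\bigl(e^{itu}-1-it\sin u\bigr)\,d\Lambda(u)\Bigr\},\quad t\in\mathbb{R},$$ for some $\gamma\in\mathbb{R}$, $\sigma^2\geqslant 0$, and some real-valued function $\Lambda$ on $\mathbb{R}\setminus\{0\}$ (the Lévy spectral function, not necessarily monotone) which has finite total variation on every interval $(-\infty,-r]$ and $[r,\infty)$, $r>0$, and satisfies $$\lim_{u\to-\infty}\Lambda(u)=\lim_{u\to+\infty}\Lambda(u)=0\quad\text{and}\quad\int_{0<|u|<\delta}u^2\,d|\Lambda|(u)<+\infty\ \text{ for every }\delta>0.$$ Integrals with respect to $\Lambda$ are Stieltjes integrals, and $d|\Lambda|$ denotes integration with respect to the total variation of $\Lambda$. *)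

theory Defs
  imports "HOL-Probability.Characteristic_Functions"
begin

definition variation_sums :: "(real \<Rightarrow> real) \<Rightarrow> real set \<Rightarrow> real set" where
  "variation_sums g S =
     {(\<Sum>i<n. \<bar>g (t (Suc i)) - g (t i)\<bar>) | (n::nat) t.
        (\<forall>i\<le>n. t i \<in> S) \<and> (\<forall>i<n. t i \<le> t (Suc i))}"

definition finite_variation_on :: "(real \<Rightarrow> real) \<Rightarrow> real set \<Rightarrow> bool" where
  "finite_variation_on g S \<longleftrightarrow> bdd_above (variation_sums g S)"

(* A supremum in the reals: meaningful only if finite_variation_on g S and S is nonempty. *)
definition total_variation_on :: "(real \<Rightarrow> real) \<Rightarrow> real set \<Rightarrow> real" where
  "total_variation_on g S = Sup (variation_sums g S)"

(* Riemann-Stieltjes integral of h with respect to g over {a..b}, as the limit of tagged sums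
   when the mesh tends to 0. Every K in a tagged division is a nonempty closed interval
   {Inf K..Sup K}. *)
definition has_stieltjes_integral ::
  "(real \<Rightarrow> 'a::real_normed_vector) \<Rightarrow> (real \<Rightarrow> real) \<Rightarrow> 'a \<Rightarrow> real \<Rightarrow> real \<Rightarrow> bool" where
  "has_stieltjes_integral h g I a b \<longleftrightarrow>
     (\<forall>e>0. \<exists>d>0. \<forall>p. p tagged_division_of {a..b} \<and> (\<lambda>x. ball x d) fine p \<longrightarrow>
        norm ((\<Sum>(x,K)\<in>p. (g (Sup K) - g (Inf K)) *\<^sub>R h x) - I) < e)"

(* Improper Stieltjes integral over an open interval S, possibly unbounded: the limit of the
   integrals over compact subintervals {a..b} of S as these exhaust S. Only the values of h and
   g on S matter, so g need not be defined or bounded at the ends of S. *)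
definition has_improper_stieltjes_integral ::
  "(real \<Rightarrow> 'a::real_normed_vector) \<Rightarrow> (real \<Rightarrow> real) \<Rightarrow> 'a \<Rightarrow> real set \<Rightarrow> bool" where
  "has_improper_stieltjes_integral h g I S \<longleftrightarrow>
     (\<forall>e>0. \<exists>c\<in>S. \<exists>d\<in>S. \<forall>a\<in>S. \<forall>b\<in>S. a \<le> c \<and> d \<le> b \<and> a \<le> b \<longrightarrow>
        (\<exists>J. has_stieltjes_integral h g J a b \<and> norm (J - I) < e))"

(* The nondecreasing function |Lambda| on each half-line of R - {0}, normalised to tend to 0 at
   both infinities; its increment over an interval not containing 0 is the total variation of
   Lambda there. *)
definition variation_function :: "(real \<Rightarrow> real) \<Rightarrow> real \<Rightarrow> real" where
  "variation_function \<Lambda> u =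
     (if u < 0 then total_variation_on \<Lambda> {..u} else - total_variation_on \<Lambda> {u..})"

(* A function on R - {0} is represented by a total function whose value at 0 is never used. *)
definition levy_spectral_function :: "(real \<Rightarrow> real) \<Rightarrow> bool" where
  "levy_spectral_function \<Lambda> \<longleftrightarrow>
     (\<forall>r>0. finite_variation_on \<Lambda> {..-r} \<and> finite_variation_on \<Lambda> {r..}) \<and>
     (\<Lambda> \<longlongrightarrow> 0) at_bot \<and> (\<Lambda> \<longlongrightarrow> 0) at_top \<and>
     (\<forall>\<delta>>0.
        (\<exists>I. has_improper_stieltjes_integral (\<lambda>u. u\<^sup>2) (variation_function \<Lambda>) I {-\<delta><..<0}) \<and>
        (\<exists>I. has_improper_stieltjes_integral (\<lambda>u. u\<^sup>2) (variation_function \<Lambda>) I {0<..<\<delta>}))"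

definition has_levy_integral ::
  "(real \<Rightarrow> complex) \<Rightarrow> (real \<Rightarrow> real) \<Rightarrow> complex \<Rightarrow> bool" where
  "has_levy_integral h \<Lambda> I \<longleftrightarrow>
     (\<exists>I1 I2. has_improper_stieltjes_integral h \<Lambda> I1 {..<0} \<and>
              has_improper_stieltjes_integral h \<Lambda> I2 {0<..} \<and> I = I1 + I2)"

definition quasi_infinitely_divisible :: "(real \<Rightarrow> real) \<Rightarrow> bool" where
  "quasi_infinitely_divisible F \<longleftrightarrow>
     (\<exists>M. real_distribution M \<and> cdf M = F \<and>
        (\<exists>\<gamma> \<sigma>2 \<Lambda>. \<sigma>2 \<ge> 0 \<and> levy_spectral_function \<Lambda> \<and>
           (\<forall>t. \<exists>I.
              has_levy_integral (\<lambda>u. iexp (t * u) - 1 - \<i> * complex_of_real (t * sin u)) \<Lambda> I \<and>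
              char M t = exp (\<i> * complex_of_real (t * \<gamma>) - complex_of_real (\<sigma>2 * t\<^sup>2 / 2) + I))))"

end

theory Submission
  imports Defs "HOL-Probability.Probability"
begin

text \<open>
  Let \<open>f\<close> be the characteristic function of a discrete law, and suppose that \<open>f\<close> has a
  Levy-Khinchine representation with a spectral function \<open>\<Lambda>\<close> of possibly infinite variation
  near \<open>0\<close>. Taking the second difference of the exponent with step \<open>h\<close> cancels every term that is
  affine in \<open>t\<close> and leaves
  \<open>-\<sigma>\<^sup>2 h\<^sup>2 + \<integral> e\<^sup>i\<^sup>t\<^sup>u \<cdot> 2 (cos (h u) - 1) d\<Lambda>(u)\<close>.
  The integrand is bounded by both \<open>h\<^sup>2 u\<^sup>2\<close> and \<open>4\<close>, so the integral is bounded uniformly in \<open>t\<close>: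
  near \<open>0\<close> by the integrability of \<open>u\<^sup>2\<close> against \<open>|\<Lambda>|\<close>, and away from \<open>0\<close> by the finite variation
  of \<open>\<Lambda>\<close> (\<open>improper_integral_bound_pos\<close>, \<open>improper_integral_bound_neg\<close>). Hence, for each \<open>h\<close>,
  there is a constant \<open>C\<close> with \<open>|f(t)|\<^sup>2 \<le> C |f(t + h)| |f(t - h)|\<close> for all \<open>t\<close>
  (\<open>levy_khinchine_second_difference\<close>).

  With \<open>t = s + r\<close> and \<open>h = r\<close> this reads \<open>|f(s + r)|\<^sup>2 \<le> C |f(s + 2 r)| |f(s)| \<le> C |f(s)|\<close>: where
  \<open>|f(s)|\<close> is small, \<open>f\<close> is small at every fixed translate of \<open>s\<close>. But \<open>f\<close> is a uniformly
  convergent trigonometric series with a nonzero coefficient, and averaging along an arithmetic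
  progression recovers this coefficient up to a small error. Therefore there are a finite set \<open>R\<close>
  and \<open>\<epsilon> > 0\<close> such that every \<open>s\<close> has some \<open>r \<in> R\<close> with \<open>|f(s + r)| \<ge> \<epsilon>\<close>
  (\<open>discrete_char_large_on_finite_translates\<close>). Consequently \<open>|f|\<close> is bounded away from \<open>0\<close>,
  which contradicts the infimum being \<open>0\<close>.
\<close>

section \<open>Riemann-Stieltjes integrals\<close>

lemma has_stieltjes_integralE:
  assumes "has_stieltjes_integral h g I a b" and "e > 0"
  obtains d where "d > 0" and "\<And>p. p tagged_division_of {a..b} \<Longrightarrow> (\<lambda>x. ball x d) fine p \<Longrightarrow>
    norm ((\<Sum>(x,K)\<in>p. (g (Sup K) - g (Inf K)) *\<^sub>R h x) - I) < e"
proof -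
  obtain d where d: "d > 0 \<and> (\<forall>p. p tagged_division_of {a..b} \<and> (\<lambda>x. ball x d) fine p \<longrightarrow>
      norm ((\<Sum>(x,K)\<in>p. (g (Sup K) - g (Inf K)) *\<^sub>R h x) - I) < e)"
    using assms(1)[unfolded has_stieltjes_integral_def, rule_format, OF assms(2)] by (rule exE)
  show ?thesis
    by (rule that[OF d[THEN conjunct1] d[THEN conjunct2, rule_format, OF conjI]])
qed

lemma has_improper_stieltjes_integralE:
  assumes "has_improper_stieltjes_integral h g I S" and "e > 0"
  obtains c d where "c \<in> S" "d \<in> S"
    and "\<And>a b. a \<in> S \<Longrightarrow> b \<in> S \<Longrightarrow> a \<le> c \<and> d \<le> b \<and> a \<le> b \<Longrightarrow>
      \<exists>J. has_stieltjes_integral h g J a b \<and> norm (J - I) < e"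
proof -
  obtain c d where cd: "c \<in> S" "d \<in> S"
      "\<forall>a\<in>S. \<forall>b\<in>S. a \<le> c \<and> d \<le> b \<and> a \<le> b \<longrightarrow>
        (\<exists>J. has_stieltjes_integral h g J a b \<and> norm (J - I) < e)"
    using assms(1)[unfolded has_improper_stieltjes_integral_def, rule_format, OF assms(2)]
    by (elim bexE)
  show ?thesis
    by (rule that[OF cd(1,2) cd(3)[rule_format]])
qed

lemma ball_fine_mono:
  assumes "(\<lambda>x. ball x d) fine p" and "d \<le> d'"
  shows "(\<lambda>x. ball x d') fine p"
proof (rule fineI)
  fix x K assume "(x, K) \<in> p"
  then have "K \<subseteq> ball x d" by (rule fineD[OF assms(1)])
  also have "\<dots> \<subseteq> ball x d'" by (rule subset_ball[OF assms(2)])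
  finally show "K \<subseteq> ball x d'" .
qed

lemma has_stieltjes_integral_add:
  assumes "has_stieltjes_integral f g I a b" and "has_stieltjes_integral h g J a b"
  shows "has_stieltjes_integral (\<lambda>u. f u + h u) g (I + J) a b"
  unfolding has_stieltjes_integral_def
proof (intro allI impI)
  fix e :: real assume "e > 0"
  then have "e/2 > 0" by simp
  obtain d1 where d1': "d1 > 0"
    and d1: "\<And>p. p tagged_division_of {a..b} \<Longrightarrow> (\<lambda>x. ball x d1) fine p \<Longrightarrow>
        norm ((\<Sum>(x,K)\<in>p. (g (Sup K) - g (Inf K)) *\<^sub>R f x) - I) < e/2"
    using has_stieltjes_integralE[OF assms(1) \<open>e/2 > 0\<close>] by blast
  obtain d2 where d2': "d2 > 0"
    and d2: "\<And>p. p tagged_division_of {a..b} \<Longrightarrow> (\<lambda>x. ball x d2) fine p \<Longrightarrow>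
        norm ((\<Sum>(x,K)\<in>p. (g (Sup K) - g (Inf K)) *\<^sub>R h x) - J) < e/2"
    using has_stieltjes_integralE[OF assms(2) \<open>e/2 > 0\<close>] by blast
  show "\<exists>d>0. \<forall>p. p tagged_division_of {a..b} \<and> (\<lambda>x. ball x d) fine p \<longrightarrow>
        norm ((\<Sum>(x,K)\<in>p. (g (Sup K) - g (Inf K)) *\<^sub>R (f x + h x)) - (I + J)) < e"
  proof (intro exI[of _ "min d1 d2"] conjI allI impI)
    fix p assume p: "p tagged_division_of {a..b} \<and> (\<lambda>x. ball x (min d1 d2)) fine p"
    then have "(\<lambda>x. ball x d1) fine p" "(\<lambda>x. ball x d2) fine p"
      by (auto elim: ball_fine_mono)
    then have "norm (((\<Sum>(x,K)\<in>p. (g (Sup K) - g (Inf K)) *\<^sub>R f x) - I)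
        + ((\<Sum>(x,K)\<in>p. (g (Sup K) - g (Inf K)) *\<^sub>R h x) - J)) < e"
      using d1[of p] d2[of p] p by (intro norm_triangle_lt) simp
    moreover have "(\<Sum>(x,K)\<in>p. (g (Sup K) - g (Inf K)) *\<^sub>R (f x + h x))
        = (\<Sum>(x,K)\<in>p. (g (Sup K) - g (Inf K)) *\<^sub>R f x) + (\<Sum>(x,K)\<in>p. (g (Sup K) - g (Inf K)) *\<^sub>R h x)"
      by (simp add: sum.distrib[symmetric] split_def scaleR_add_right)
    ultimately show "norm ((\<Sum>(x,K)\<in>p. (g (Sup K) - g (Inf K)) *\<^sub>R (f x + h x)) - (I + J)) < e"
      by (simp add: algebra_simps)
  qed (use d1' d2' in simp)
qed

lemma has_stieltjes_integral_scaleR: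
  assumes "has_stieltjes_integral f g I a b"
  shows "has_stieltjes_integral (\<lambda>u. c *\<^sub>R f u) g (c *\<^sub>R I) a b"
  unfolding has_stieltjes_integral_def
proof (intro allI impI)
  fix e :: real assume "e > 0"
  then have "e / (\<bar>c\<bar> + 1) > 0" by simp
  then obtain d where d: "d > 0"
    and d1: "\<And>p. p tagged_division_of {a..b} \<Longrightarrow> (\<lambda>x. ball x d) fine p \<Longrightarrow>
        norm ((\<Sum>(x,K)\<in>p. (g (Sup K) - g (Inf K)) *\<^sub>R f x) - I) < e / (\<bar>c\<bar> + 1)"
    using has_stieltjes_integralE[OF assms] by blast
  show "\<exists>d>0. \<forall>p. p tagged_division_of {a..b} \<and> (\<lambda>x. ball x d) fine p \<longrightarrow>
        norm ((\<Sum>(x,K)\<in>p. (g (Sup K) - g (Inf K)) *\<^sub>R (c *\<^sub>R f x)) - c *\<^sub>R I) < e"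
  proof (intro exI[of _ d] conjI allI impI d)
    fix p assume p: "p tagged_division_of {a..b} \<and> (\<lambda>x. ball x d) fine p"
    let ?D = "(\<Sum>(x,K)\<in>p. (g (Sup K) - g (Inf K)) *\<^sub>R f x) - I"
    have "(\<Sum>(x,K)\<in>p. (g (Sup K) - g (Inf K)) *\<^sub>R (c *\<^sub>R f x)) - c *\<^sub>R I = c *\<^sub>R ?D"
      by (simp add: scaleR_sum_right split_def scaleR_diff_right mult.commute)
    moreover have "\<bar>c\<bar> * norm ?D \<le> (\<bar>c\<bar> + 1) * norm ?D"
      by (simp add: mult_right_mono)
    moreover have "(\<bar>c\<bar> + 1) * norm ?D < e"
      using d1[of p] p by (simp add: field_simps)
    ultimately show "norm ((\<Sum>(x,K)\<in>p. (g (Sup K) - g (Inf K)) *\<^sub>R (c *\<^sub>R f x)) - c *\<^sub>R I) < e"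
      by simp
  qed
qed

lemma has_stieltjes_integral_const:
  fixes c :: real
  assumes "a \<le> b"
  shows "has_stieltjes_integral (\<lambda>_. c) V (c * (V b - V a)) a b"
proof -
  have "(\<Sum>(x,K)\<in>p. (V (Sup K) - V (Inf K)) *\<^sub>R c) = c * (V b - V a)"
    if "p tagged_division_of {a..b}" for p
    using additive_tagged_division_1[OF assms that, of V]
    by (simp add: sum_distrib_left[symmetric] split_def mult.commute[of _ c])
  then show ?thesis
    unfolding has_stieltjes_integral_def by (auto intro: exI[of _ 1])
qed

lemma riemann_stieltjes_sum_bound:
  fixes h :: "real \<Rightarrow> 'a::real_normed_vector"
  assumes p: "p tagged_division_of {a..b}"
    and dom: "\<And>u v. a \<le> u \<Longrightarrow> u \<le> v \<Longrightarrow> v \<le> b \<Longrightarrow> \<bar>g v - g u\<bar> \<le> V v - V u"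
    and bound: "\<And>u. a \<le> u \<Longrightarrow> u \<le> b \<Longrightarrow> norm (h u) \<le> k u"
  shows "(\<Sum>(x,K)\<in>p. norm ((g (Sup K) - g (Inf K)) *\<^sub>R h x))
      \<le> (\<Sum>(x,K)\<in>p. (V (Sup K) - V (Inf K)) *\<^sub>R k x)"
proof (rule sum_mono, safe)
  fix x K assume xK: "(x, K) \<in> p"
  obtain u v where K: "K = {u..v}"
    using tagged_division_ofD(4)[OF p xK] by (auto simp: cbox_interval)
  have "x \<in> {u..v}" "{u..v} \<subseteq> {a..b}"
    using tagged_division_ofD(2,3)[OF p xK] K by auto
  then have *: "a \<le> u" "u \<le> v" "v \<le> b" "a \<le> x" "x \<le> b" by auto
  show "norm ((g (Sup K) - g (Inf K)) *\<^sub>R h x) \<le> (V (Sup K) - V (Inf K)) *\<^sub>R k x"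
    unfolding K using * dom[OF *(1-3)] bound[OF *(4,5)]
    by (auto intro!: mult_mono intro: order_trans[OF norm_ge_zero])
qed

text \<open>If the increments of \<open>g\<close> are dominated by those of \<open>V\<close>, an integral against \<open>g\<close> can be
  estimated by integrals against \<open>V\<close>, with different majorants on either side of a point \<open>m\<close>.
  Integrability of \<open>h\<close> on the two parts is not needed: the union of fine tagged divisions of the
  parts is a fine tagged division of the whole interval.\<close>

lemma norm_stieltjes_integral_le:
  fixes h :: "real \<Rightarrow> 'a::real_normed_vector"
  assumes h: "has_stieltjes_integral h g J a b"
    and k1: "has_stieltjes_integral k1 V J1 a m" and k2: "has_stieltjes_integral k2 V J2 m b"
    and "a \<le> m" "m \<le> b"
    and dom: "\<And>u v. a \<le> u \<Longrightarrow> u \<le> v \<Longrightarrow> v \<le> b \<Longrightarrow> \<bar>g v - g u\<bar> \<le> V v - V u"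
    and b1: "\<And>u. a \<le> u \<Longrightarrow> u \<le> m \<Longrightarrow> norm (h u) \<le> k1 u"
    and b2: "\<And>u. m \<le> u \<Longrightarrow> u \<le> b \<Longrightarrow> norm (h u) \<le> k2 u"
  shows "norm J \<le> J1 + J2"
proof (rule field_le_epsilon)
  fix e :: real assume "e > 0"
  then have "e/3 > 0" by simp
  obtain d where d: "d > 0"
    and dh: "\<And>p. p tagged_division_of {a..b} \<Longrightarrow> (\<lambda>x. ball x d) fine p \<Longrightarrow>
        norm ((\<Sum>(x,K)\<in>p. (g (Sup K) - g (Inf K)) *\<^sub>R h x) - J) < e/3"
    using has_stieltjes_integralE[OF h \<open>e/3 > 0\<close>] by blast
  obtain d1 where d1: "d1 > 0"
    and dk1: "\<And>p. p tagged_division_of {a..m} \<Longrightarrow> (\<lambda>x. ball x d1) fine p \<Longrightarrow>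
        norm ((\<Sum>(x,K)\<in>p. (V (Sup K) - V (Inf K)) *\<^sub>R k1 x) - J1) < e/3"
    using has_stieltjes_integralE[OF k1 \<open>e/3 > 0\<close>] by blast
  obtain d2 where d2: "d2 > 0"
    and dk2: "\<And>p. p tagged_division_of {m..b} \<Longrightarrow> (\<lambda>x. ball x d2) fine p \<Longrightarrow>
        norm ((\<Sum>(x,K)\<in>p. (V (Sup K) - V (Inf K)) *\<^sub>R k2 x) - J2) < e/3"
    using has_stieltjes_integralE[OF k2 \<open>e/3 > 0\<close>] by blast
  define d' where "d' = min d (min d1 d2)"
  have "gauge (\<lambda>x::real. ball x d')" using d d1 d2 by (auto simp: d'_def)
  then obtain p1 p2 where p1: "p1 tagged_division_of {a..m}" "(\<lambda>x. ball x d') fine p1"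
    and p2: "p2 tagged_division_of {m..b}" "(\<lambda>x. ball x d') fine p2"
    by (metis fine_division_exists_real)
  have fine: "(\<lambda>x. ball x d1) fine p1" "(\<lambda>x. ball x d2) fine p2" "(\<lambda>x. ball x d) fine (p1 \<union> p2)"
    using p1(2) p2(2) unfolding d'_def by (auto intro!: fine_Un elim: ball_fine_mono)
  have "(p1 \<union> p2) tagged_division_of ({a..m} \<union> {m..b})"
    by (rule tagged_division_Un[OF p1(1) p2(1)]) auto
  also have "{a..m} \<union> {m..b} = {a..b}" using assms by auto
  finally have p: "(p1 \<union> p2) tagged_division_of {a..b}" .
  have fin: "finite p1" "finite p2"
    using p1(1) p2(1) by (auto intro: tagged_division_of_finite)
  let ?t = "\<lambda>(x,K). (g (Sup K) - g (Inf K)) *\<^sub>R h x"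
  have "norm (sum ?t (p1 \<union> p2)) \<le> (\<Sum>z\<in>p1 \<union> p2. norm (?t z))" by (rule norm_sum)
  also have "\<dots> \<le> (\<Sum>z\<in>p1. norm (?t z)) + (\<Sum>z\<in>p2. norm (?t z))"
    using sum.union_inter[OF fin, of "\<lambda>z. norm (?t z)"] sum_nonneg[of "p1 \<inter> p2" "\<lambda>z. norm (?t z)"]
    by simp
  also have "\<dots> \<le> (\<Sum>(x,K)\<in>p1. (V (Sup K) - V (Inf K)) *\<^sub>R k1 x)
      + (\<Sum>(x,K)\<in>p2. (V (Sup K) - V (Inf K)) *\<^sub>R k2 x)"
    using riemann_stieltjes_sum_bound[OF p1(1), of g V h k1]
      riemann_stieltjes_sum_bound[OF p2(1), of g V h k2] assms(4,5) dom b1 b2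
    by (intro add_mono) (auto simp: split_def)
  finally have "norm (sum ?t (p1 \<union> p2)) \<le> (J1 + e/3) + (J2 + e/3)"
    using dk1[OF p1(1) fine(1)] dk2[OF p2(1) fine(2)] unfolding real_norm_def by linarith
  moreover have "norm J \<le> norm (sum ?t (p1 \<union> p2)) + norm (sum ?t (p1 \<union> p2) - J)"
    using norm_triangle_sub[of J "sum ?t (p1 \<union> p2)"] norm_minus_commute[of J "sum ?t (p1 \<union> p2)"]
    by linarith
  ultimately show "norm J \<le> J1 + J2 + e"
    using dh[OF p fine(3)] by linarith
qed

lemma has_improper_stieltjes_integral_add:
  fixes S :: "real set"
  assumes "has_improper_stieltjes_integral f g I S" and "has_improper_stieltjes_integral h g J S"
  shows "has_improper_stieltjes_integral (\<lambda>u. f u + h u) g (I + J) S"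
  unfolding has_improper_stieltjes_integral_def
proof (intro allI impI)
  fix e :: real assume "e > 0"
  then have "e/2 > 0" by simp
  obtain c d where S: "c \<in> S" "d \<in> S"
    and 1: "\<And>a b. a \<in> S \<Longrightarrow> b \<in> S \<Longrightarrow> a \<le> c \<and> d \<le> b \<and> a \<le> b \<Longrightarrow>
        \<exists>I'. has_stieltjes_integral f g I' a b \<and> norm (I' - I) < e/2"
    using has_improper_stieltjes_integralE[OF assms(1) \<open>e/2 > 0\<close>] by blast
  obtain c' d' where S': "c' \<in> S" "d' \<in> S"
    and 2: "\<And>a b. a \<in> S \<Longrightarrow> b \<in> S \<Longrightarrow> a \<le> c' \<and> d' \<le> b \<and> a \<le> b \<Longrightarrow>
        \<exists>J'. has_stieltjes_integral h g J' a b \<and> norm (J' - J) < e/2"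
    using has_improper_stieltjes_integralE[OF assms(2) \<open>e/2 > 0\<close>] by blast
  show "\<exists>c\<in>S. \<exists>d\<in>S. \<forall>a\<in>S. \<forall>b\<in>S. a \<le> c \<and> d \<le> b \<and> a \<le> b \<longrightarrow>
      (\<exists>J'. has_stieltjes_integral (\<lambda>u. f u + h u) g J' a b \<and> norm (J' - (I + J)) < e)"
  proof (rule bexI[of _ "min c c'"], rule bexI[of _ "max d d'"], intro ballI impI)
    fix a b assume "a \<in> S" "b \<in> S" "a \<le> min c c' \<and> max d d' \<le> b \<and> a \<le> b"
    then obtain I' J' where I': "has_stieltjes_integral f g I' a b" "norm (I' - I) < e/2"
      and J': "has_stieltjes_integral h g J' a b" "norm (J' - J) < e/2"
      using 1[of a b] 2[of a b] by auto
    have "norm ((I' - I) + (J' - J)) < e" using I'(2) J'(2) by (intro norm_triangle_lt) simp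
    then show "\<exists>J'. has_stieltjes_integral (\<lambda>u. f u + h u) g J' a b \<and> norm (J' - (I + J)) < e"
      using has_stieltjes_integral_add[OF I'(1) J'(1)] by (intro exI[of _ "I' + J'"]) (simp add: algebra_simps)
  qed (use S S' in \<open>auto simp: min_def max_def\<close>)
qed

lemma has_improper_stieltjes_integral_scaleR:
  fixes S :: "real set"
  assumes "has_improper_stieltjes_integral f g I S"
  shows "has_improper_stieltjes_integral (\<lambda>u. r *\<^sub>R f u) g (r *\<^sub>R I) S"
  unfolding has_improper_stieltjes_integral_def
proof (intro allI impI)
  fix e :: real assume "e > 0"
  then have "e / (\<bar>r\<bar> + 1) > 0" by simp
  then obtain c d where S: "c \<in> S" "d \<in> S"
    and 1: "\<And>a b. a \<in> S \<Longrightarrow> b \<in> S \<Longrightarrow> a \<le> c \<and> d \<le> b \<and> a \<le> b \<Longrightarrow>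
        \<exists>I'. has_stieltjes_integral f g I' a b \<and> norm (I' - I) < e / (\<bar>r\<bar> + 1)"
    using has_improper_stieltjes_integralE[OF assms] by blast
  show "\<exists>c\<in>S. \<exists>d\<in>S. \<forall>a\<in>S. \<forall>b\<in>S. a \<le> c \<and> d \<le> b \<and> a \<le> b \<longrightarrow>
      (\<exists>J. has_stieltjes_integral (\<lambda>u. r *\<^sub>R f u) g J a b \<and> norm (J - r *\<^sub>R I) < e)"
  proof (rule bexI[OF _ S(1)], rule bexI[OF _ S(2)], intro ballI impI)
    fix a b assume "a \<in> S" "b \<in> S" "a \<le> c \<and> d \<le> b \<and> a \<le> b"
    then obtain I' where I': "has_stieltjes_integral f g I' a b" "norm (I' - I) < e / (\<bar>r\<bar> + 1)"
      using 1[of a b] by auto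
    have "norm (r *\<^sub>R I' - r *\<^sub>R I) = \<bar>r\<bar> * norm (I' - I)"
      by (simp flip: scaleR_diff_right)
    also have "\<dots> \<le> (\<bar>r\<bar> + 1) * norm (I' - I)" by (simp add: mult_right_mono)
    also have "\<dots> < e" using I'(2) by (simp add: field_simps)
    finally show "\<exists>J. has_stieltjes_integral (\<lambda>u. r *\<^sub>R f u) g J a b \<and> norm (J - r *\<^sub>R I) < e"
      using has_stieltjes_integral_scaleR[OF I'(1)] by blast
  qed
qed

section \<open>Bounds for integrals against a spectral function\<close>

lemma variation_sums_le_total_variation:
  "finite_variation_on g S \<Longrightarrow> s \<in> variation_sums g S \<Longrightarrow> s \<le> total_variation_on g S"
  unfolding finite_variation_on_def total_variation_on_def by (rule cSup_upper)

lemma zero_in_variation_sums: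
  assumes "S \<noteq> {}"
  shows "0 \<in> variation_sums g S"
proof -
  from assms obtain a where "a \<in> S" by blast
  then show ?thesis
    unfolding variation_sums_def by (intro CollectI exI[of _ "0::nat"] exI[of _ "\<lambda>_. a"]) simp
qed

lemma total_variation_nonneg:
  "finite_variation_on g S \<Longrightarrow> S \<noteq> {} \<Longrightarrow> 0 \<le> total_variation_on g S"
  by (simp add: variation_sums_le_total_variation zero_in_variation_sums)

text \<open>Any sum for the variation on \<open>{v..}\<close> extends to one on \<open>{u..}\<close> by prepending the points
  \<open>u\<close> and \<open>v\<close>; symmetrically on left half-lines, by appending.\<close>

lemma total_variation_atLeast:
  assumes fin: "finite_variation_on g {u..}" and "u \<le> v"
  shows "\<bar>g v - g u\<bar> + total_variation_on g {v..} \<le> total_variation_on g {u..}"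
proof -
  have "total_variation_on g {v..} \<le> total_variation_on g {u..} - \<bar>g v - g u\<bar>"
    unfolding total_variation_on_def[of g "{v..}"]
  proof (rule cSup_least)
    show "variation_sums g {v..} \<noteq> {}" using zero_in_variation_sums[of "{v..}" g] by auto
    fix s assume "s \<in> variation_sums g {v..}"
    then obtain n t where s: "s = (\<Sum>i<n. \<bar>g (t (Suc i)) - g (t i)\<bar>)"
      and t: "\<forall>i\<le>n. t i \<in> {v..}" "\<forall>i<n. t i \<le> t (Suc i)"
      unfolding variation_sums_def by auto
    define t' where "t' = case_nat u (case_nat v t)"
    have "(\<Sum>i<Suc (Suc n). \<bar>g (t' (Suc i)) - g (t' i)\<bar>) \<in> variation_sums g {u..}"
      unfolding variation_sums_def mem_Collect_eq
    proof (intro exI conjI allI impI)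
      show "t' i \<in> {u..}" if "i \<le> Suc (Suc n)" for i
        using t(1) \<open>u \<le> v\<close> that by (fastforce simp: t'_def split: nat.split)
      show "t' i \<le> t' (Suc i)" if "i < Suc (Suc n)" for i
        using t \<open>u \<le> v\<close> that by (auto simp: t'_def split: nat.split)
    qed simp
    moreover have "(\<Sum>i<Suc (Suc n). \<bar>g (t' (Suc i)) - g (t' i)\<bar>) = \<bar>g v - g u\<bar> + \<bar>g (t 0) - g v\<bar> + s"
      unfolding s sum.lessThan_Suc_shift by (simp add: t'_def)
    ultimately show "s \<le> total_variation_on g {u..} - \<bar>g v - g u\<bar>"
      using variation_sums_le_total_variation[OF fin] by fastforce
  qed
  then show ?thesis by simp
qed

lemma total_variation_atMost:
  assumes fin: "finite_variation_on g {..v}" and "u \<le> v"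
  shows "\<bar>g v - g u\<bar> + total_variation_on g {..u} \<le> total_variation_on g {..v}"
proof -
  have "total_variation_on g {..u} \<le> total_variation_on g {..v} - \<bar>g v - g u\<bar>"
    unfolding total_variation_on_def[of g "{..u}"]
  proof (rule cSup_least)
    show "variation_sums g {..u} \<noteq> {}" using zero_in_variation_sums[of "{..u}" g] by auto
    fix s assume "s \<in> variation_sums g {..u}"
    then obtain n t where s: "s = (\<Sum>i<n. \<bar>g (t (Suc i)) - g (t i)\<bar>)"
      and t: "\<forall>i\<le>n. t i \<in> {..u}" "\<forall>i<n. t i \<le> t (Suc i)"
      unfolding variation_sums_def by auto
    define t' where "t' i = (if i \<le> n then t i else if i = Suc n then u else v)" for i
    have "(\<Sum>i<Suc (Suc n). \<bar>g (t' (Suc i)) - g (t' i)\<bar>) \<in> variation_sums g {..v}"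
      unfolding variation_sums_def mem_Collect_eq
    proof (intro exI conjI allI impI)
      show "t' i \<in> {..v}" if "i \<le> Suc (Suc n)" for i
        using t(1) \<open>u \<le> v\<close> by (force simp: t'_def)
      show "t' i \<le> t' (Suc i)" if "i < Suc (Suc n)" for i
      proof -
        consider "i < n" | "i = n" | "i = Suc n" using \<open>i < Suc (Suc n)\<close> by linarith
        then show ?thesis using t \<open>u \<le> v\<close> by cases (auto simp: t'_def)
      qed
    qed simp
    moreover have "(\<Sum>i<Suc (Suc n). \<bar>g (t' (Suc i)) - g (t' i)\<bar>) = s + \<bar>g u - g (t n)\<bar> + \<bar>g v - g u\<bar>"
      unfolding s by (simp add: t'_def)
    ultimately show "s \<le> total_variation_on g {..v} - \<bar>g v - g u\<bar>"
      using variation_sums_le_total_variation[OF fin] by fastforce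
  qed
  then show ?thesis by simp
qed

lemma variation_function_dominates:
  assumes "levy_spectral_function \<Lambda>" and "u \<le> v" and "0 < u \<or> v < 0"
  shows "\<bar>\<Lambda> v - \<Lambda> u\<bar> \<le> variation_function \<Lambda> v - variation_function \<Lambda> u"
  using assms(3)
proof
  assume "0 < u"
  then have "finite_variation_on \<Lambda> {u..}"
    using assms(1) by (auto simp: levy_spectral_function_def)
  from total_variation_atLeast[OF this \<open>u \<le> v\<close>] \<open>0 < u\<close> \<open>u \<le> v\<close> show ?thesis
    by (simp add: variation_function_def)
next
  assume "v < 0"
  then have "finite_variation_on \<Lambda> {..v}"
    using assms(1) by (metis levy_spectral_function_def minus_minus neg_0_less_iff_less)
  from total_variation_atMost[OF this \<open>u \<le> v\<close>] \<open>v < 0\<close> \<open>u \<le> v\<close> show ?thesis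
    by (simp add: variation_function_def)
qed

lemma variation_function_sign:
  assumes "levy_spectral_function \<Lambda>"
  shows "u > 0 \<Longrightarrow> variation_function \<Lambda> u \<le> 0" and "u < 0 \<Longrightarrow> variation_function \<Lambda> u \<ge> 0"
proof -
  assume "u > 0"
  then have "finite_variation_on \<Lambda> {u..}"
    using assms by (auto simp: levy_spectral_function_def)
  from total_variation_nonneg[OF this] \<open>u > 0\<close> show "variation_function \<Lambda> u \<le> 0"
    by (simp add: variation_function_def)
next
  assume "u < 0"
  then have "finite_variation_on \<Lambda> {..u}"
    using assms by (metis levy_spectral_function_def minus_minus neg_0_less_iff_less)
  from total_variation_nonneg[OF this] \<open>u < 0\<close> show "variation_function \<Lambda> u \<ge> 0"
    by (simp add: variation_function_def)
qed

text \<open>The bound \<open>B\<close> depends only on \<open>\<Lambda>\<close> and on the constants \<open>C\<close> and \<open>D\<close>, not on the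
  integrand. This gives uniformity in \<open>t\<close> below.\<close>

lemma improper_integral_bound_pos:
  assumes L: "levy_spectral_function \<Lambda>" and "0 \<le> D"
  obtains B where "\<And>(q::real \<Rightarrow> 'a::real_normed_vector) I.
    (\<And>u. norm (q u) \<le> C * u\<^sup>2) \<Longrightarrow> (\<And>u. norm (q u) \<le> D) \<Longrightarrow>
    has_improper_stieltjes_integral q \<Lambda> I {0<..} \<Longrightarrow> norm I \<le> B"
proof -
  let ?V = "variation_function \<Lambda>"
  obtain I0 where "has_improper_stieltjes_integral (\<lambda>u. u\<^sup>2) ?V I0 {0<..<1}"
    using L unfolding levy_spectral_function_def by (meson zero_less_one)
  from has_improper_stieltjes_integralE[OF this zero_less_one] obtain c d where cd: "c \<in> {0<..<1}" "d \<in> {0<..<1}"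
    and near: "\<And>a b. a \<in> {0<..<1} \<Longrightarrow> b \<in> {0<..<1} \<Longrightarrow> a \<le> c \<and> d \<le> b \<and> a \<le> b \<Longrightarrow>
        \<exists>J. has_stieltjes_integral (\<lambda>u. u\<^sup>2) ?V J a b \<and> norm (J - I0) < 1"
    by blast
  \<comment> \<open>A splitting point independent of the integrand: \<open>u\<^sup>2\<close> is integrable over \<open>{a..m}\<close> for all
     \<open>0 < a \<le> c\<close>, with uniformly bounded integrals.\<close>
  define m where "m = max c d"
  have m: "m \<in> {0<..<1}" "c \<le> m" "d \<le> m" using cd by (auto simp: m_def)
  show ?thesis
  proof (rule that[of "\<bar>C\<bar> * (\<bar>I0\<bar> + 1) + D * (- ?V m) + 1"])
    fix q :: "real \<Rightarrow> 'a" and I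
    assume q1: "\<And>u. norm (q u) \<le> C * u\<^sup>2" and q2: "\<And>u. norm (q u) \<le> D"
      and qI: "has_improper_stieltjes_integral q \<Lambda> I {0<..}"
    obtain c' d' where cd': "c' > 0" "d' > 0"
      and int: "\<And>a b. a > 0 \<Longrightarrow> b > 0 \<Longrightarrow> a \<le> c' \<and> d' \<le> b \<and> a \<le> b \<Longrightarrow>
        \<exists>J. has_stieltjes_integral q \<Lambda> J a b \<and> norm (J - I) < 1"
      using has_improper_stieltjes_integralE[OF qI zero_less_one] unfolding greaterThan_iff by blast
    define a where "a = min c c'"
    define b where "b = max m d'"
    have ab: "0 < a" "a \<le> c" "a \<le> c'" "m \<le> b" "d' \<le> b" "a \<le> m" "a < 1"
      using cd cd' m by (auto simp: a_def b_def)
    obtain J where J: "has_stieltjes_integral q \<Lambda> J a b" "norm (J - I) < 1"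
      using int[of a b] ab by auto
    obtain J1 where J1: "has_stieltjes_integral (\<lambda>u. u\<^sup>2) ?V J1 a m" "norm (J1 - I0) < 1"
      using near[of a m] ab m by auto
    have "norm J \<le> C *\<^sub>R J1 + D * (?V b - ?V m)"
    proof (rule norm_stieltjes_integral_le[OF J(1) has_stieltjes_integral_scaleR[OF J1(1)]
          has_stieltjes_integral_const[OF \<open>m \<le> b\<close>] \<open>a \<le> m\<close> \<open>m \<le> b\<close>])
      show "\<bar>\<Lambda> v - \<Lambda> u\<bar> \<le> ?V v - ?V u" if "a \<le> u" "u \<le> v" "v \<le> b" for u v
        using variation_function_dominates[OF L] that ab by auto
    qed (use q1 q2 in auto)
    also have "C *\<^sub>R J1 \<le> \<bar>C\<bar> * (\<bar>I0\<bar> + 1)"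
    proof -
      have "C * J1 \<le> \<bar>C\<bar> * \<bar>J1\<bar>" by (metis abs_ge_self abs_mult)
      also have "\<dots> \<le> \<bar>C\<bar> * (\<bar>I0\<bar> + 1)" using J1(2) by (intro mult_left_mono) auto
      finally show ?thesis by simp
    qed
    also have "D * (?V b - ?V m) \<le> D * (- ?V m)"
      using variation_function_sign(1)[OF L, of b] ab m \<open>0 \<le> D\<close> by (intro mult_left_mono) auto
    finally have "norm J \<le> \<bar>C\<bar> * (\<bar>I0\<bar> + 1) + D * (- ?V m)" by simp
    moreover have "norm I \<le> norm J + norm (J - I)"
      by (metis norm_minus_commute norm_triangle_sub)
    ultimately show "norm I \<le> \<bar>C\<bar> * (\<bar>I0\<bar> + 1) + D * (- ?V m) + 1"
      using J(2) by linarith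
  qed
qed

lemma improper_integral_bound_neg:
  assumes L: "levy_spectral_function \<Lambda>" and "0 \<le> D"
  obtains B where "\<And>(q::real \<Rightarrow> 'a::real_normed_vector) I.
    (\<And>u. norm (q u) \<le> C * u\<^sup>2) \<Longrightarrow> (\<And>u. norm (q u) \<le> D) \<Longrightarrow>
    has_improper_stieltjes_integral q \<Lambda> I {..<0} \<Longrightarrow> norm I \<le> B"
proof -
  let ?V = "variation_function \<Lambda>"
  obtain I0 where "has_improper_stieltjes_integral (\<lambda>u. u\<^sup>2) ?V I0 {-1<..<0}"
    using L unfolding levy_spectral_function_def by (meson zero_less_one)
  from has_improper_stieltjes_integralE[OF this zero_less_one] obtain c d where cd: "c \<in> {-1<..<0}" "d \<in> {-1<..<0}"
    and near: "\<And>a b. a \<in> {-1<..<0} \<Longrightarrow> b \<in> {-1<..<0} \<Longrightarrow> a \<le> c \<and> d \<le> b \<and> a \<le> b \<Longrightarrow>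
        \<exists>J. has_stieltjes_integral (\<lambda>u. u\<^sup>2) ?V J a b \<and> norm (J - I0) < 1"
    by blast
  define m where "m = min c d"
  have m: "m \<in> {-1<..<0}" "m \<le> c" "m \<le> d" using cd by (auto simp: m_def)
  show ?thesis
  proof (rule that[of "D * ?V m + \<bar>C\<bar> * (\<bar>I0\<bar> + 1) + 1"])
    fix q :: "real \<Rightarrow> 'a" and I
    assume q1: "\<And>u. norm (q u) \<le> C * u\<^sup>2" and q2: "\<And>u. norm (q u) \<le> D"
      and qI: "has_improper_stieltjes_integral q \<Lambda> I {..<0}"
    obtain c' d' where cd': "c' < 0" "d' < 0"
      and int: "\<And>a b. a < 0 \<Longrightarrow> b < 0 \<Longrightarrow> a \<le> c' \<and> d' \<le> b \<and> a \<le> b \<Longrightarrow>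
        \<exists>J. has_stieltjes_integral q \<Lambda> J a b \<and> norm (J - I) < 1"
      using has_improper_stieltjes_integralE[OF qI zero_less_one] unfolding lessThan_iff by blast
    define a where "a = min m c'"
    define b where "b = max d d'"
    have ab: "b < 0" "d \<le> b" "a \<le> c'" "m \<le> b" "d' \<le> b" "a \<le> m" "-1 < b" "a < 0"
      using cd cd' m by (auto simp: a_def b_def)
    obtain J where J: "has_stieltjes_integral q \<Lambda> J a b" "norm (J - I) < 1"
      using int[of a b] ab by auto
    obtain J1 where J1: "has_stieltjes_integral (\<lambda>u. u\<^sup>2) ?V J1 m b" "norm (J1 - I0) < 1"
      using near[of m b] ab m by auto
    have "norm J \<le> D * (?V m - ?V a) + C *\<^sub>R J1"
    proof (rule norm_stieltjes_integral_le[OF J(1) has_stieltjes_integral_const[OF \<open>a \<le> m\<close>]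
          has_stieltjes_integral_scaleR[OF J1(1)] \<open>a \<le> m\<close> \<open>m \<le> b\<close>])
      show "\<bar>\<Lambda> v - \<Lambda> u\<bar> \<le> ?V v - ?V u" if "a \<le> u" "u \<le> v" "v \<le> b" for u v
        using variation_function_dominates[OF L] that ab by auto
    qed (use q1 q2 in auto)
    also have "C *\<^sub>R J1 \<le> \<bar>C\<bar> * (\<bar>I0\<bar> + 1)"
    proof -
      have "C * J1 \<le> \<bar>C\<bar> * \<bar>J1\<bar>" by (metis abs_ge_self abs_mult)
      also have "\<dots> \<le> \<bar>C\<bar> * (\<bar>I0\<bar> + 1)" using J1(2) by (intro mult_left_mono) auto
      finally show ?thesis by simp
    qed
    also have "D * (?V m - ?V a) \<le> D * ?V m"
      using variation_function_sign(2)[OF L, of a] ab \<open>0 \<le> D\<close> by (intro mult_left_mono) auto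
    finally have "norm J \<le> D * ?V m + \<bar>C\<bar> * (\<bar>I0\<bar> + 1)" by simp
    moreover have "norm I \<le> norm J + norm (J - I)"
      by (metis norm_minus_commute norm_triangle_sub)
    ultimately show "norm I \<le> D * ?V m + \<bar>C\<bar> * (\<bar>I0\<bar> + 1) + 1"
      using J(2) by linarith
  qed
qed

section \<open>The second difference of the logarithm\<close>

lemma iexp_second_difference:
  "iexp ((t + h) * u) + iexp ((t - h) * u) - 2 * iexp (t * u)
    = iexp (t * u) * complex_of_real (2 * (cos (h * u) - 1))"
proof -
  have iexp: "iexp y = cis y" for y by (simp add: cis_conv_exp)
  show ?thesis
    unfolding iexp
    by (simp add: complex_eq_iff distrib_right left_diff_distrib cos_add cos_diff sin_add sin_diff)
      (simp add: algebra_simps)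
qed

lemma norm_iexp_second_difference:
  fixes y :: real
  assumes "norm z = 1"
  shows "norm (z * complex_of_real (2 * (cos y - 1))) \<le> y\<^sup>2"
    and "norm (z * complex_of_real (2 * (cos y - 1))) \<le> 4"
proof -
  have n: "norm (z * complex_of_real (2 * (cos y - 1))) = 2 * (1 - cos y)"
    using assms cos_le_one[of y] by (simp only: norm_mult norm_of_real) (simp add: abs_mult)
  have "cos y = 1 - 2 * (sin (y/2))\<^sup>2" using cos_double_sin[of "y/2"] by simp
  moreover have "(sin (y/2))\<^sup>2 \<le> (y/2)\<^sup>2"
    using abs_sin_x_le_abs_x[of "y/2"] unfolding abs_le_square_iff[symmetric] by simp
  ultimately show "norm (z * complex_of_real (2 * (cos y - 1))) \<le> y\<^sup>2"
    unfolding n by (simp add: power_divide)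
  show "norm (z * complex_of_real (2 * (cos y - 1))) \<le> 4"
    unfolding n using cos_ge_minus_one[of y] by argo
qed

text \<open>The integrand of the Levy-Khinchine formula has compensator \<open>-1 - i t sin u\<close>, affine in \<open>t\<close>,
  so that it drops out of the second difference.\<close>

lemma improper_second_difference:
  assumes "\<And>t. has_improper_stieltjes_integral
      (\<lambda>u. iexp (t * u) - 1 - \<i> * complex_of_real (t * sin u)) \<Lambda> (I t) S"
  shows "has_improper_stieltjes_integral
      (\<lambda>u. iexp (t * u) * complex_of_real (2 * (cos (h * u) - 1))) \<Lambda>
      (I (t + h) + I (t - h) + (-2) *\<^sub>R I t) S"
proof -
  let ?k = "\<lambda>t u. iexp (t * u) - 1 - \<i> * complex_of_real (t * sin u)"
  have "?k (t + h) u + ?k (t - h) u + (-2) *\<^sub>R ?k t u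
      = iexp (t * u) * complex_of_real (2 * (cos (h * u) - 1))" for u
    unfolding iexp_second_difference[symmetric]
    by (simp add: scaleR_conv_of_real algebra_simps)
  then have eq: "(\<lambda>u. iexp (t * u) * complex_of_real (2 * (cos (h * u) - 1)))
      = (\<lambda>u. ?k (t + h) u + ?k (t - h) u + (-2) *\<^sub>R ?k t u)"
    by metis
  show ?thesis
    unfolding eq by (intro has_improper_stieltjes_integral_add has_improper_stieltjes_integral_scaleR assms)
qed

lemma levy_khinchine_second_difference:
  fixes f :: "real \<Rightarrow> complex"
  assumes L: "levy_spectral_function \<Lambda>"
    and f: "\<And>t. \<exists>I. has_levy_integral (\<lambda>u. iexp (t * u) - 1 - \<i> * complex_of_real (t * sin u)) \<Lambda> I \<and>
       f t = exp (\<i> * complex_of_real (t * \<gamma>) - complex_of_real (\<sigma>2 * t\<^sup>2 / 2) + I)"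
  obtains C where "\<And>t. (cmod (f t))\<^sup>2 \<le> C * (cmod (f (t + h)) * cmod (f (t - h)))"
proof -
  \<comment> \<open>The exponents are chosen as functions of \<open>t\<close>, so that second differences of them make sense.\<close>
  let ?int = "\<lambda>t I. has_improper_stieltjes_integral
      (\<lambda>u. iexp (t * u) - 1 - \<i> * complex_of_real (t * sin u)) \<Lambda> I"
  let ?g = "\<lambda>t. \<i> * complex_of_real (t * \<gamma>) - complex_of_real (\<sigma>2 * t\<^sup>2 / 2)"
  have "\<exists>z. ?int t (fst z) {..<0} \<and> ?int t (snd z) {0<..} \<and> f t = exp (?g t + (fst z + snd z))" for t
    using f[of t] unfolding has_levy_integral_def by auto
  then have "\<forall>t. \<exists>z. ?int t (fst z) {..<0} \<and> ?int t (snd z) {0<..} \<and> f t = exp (?g t + (fst z + snd z))"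
    by (rule allI)
  from choice[OF this] obtain Z where Z: "\<forall>t. ?int t (fst (Z t)) {..<0} \<and> ?int t (snd (Z t)) {0<..} \<and>
      f t = exp (?g t + (fst (Z t) + snd (Z t)))" ..
  define I1 where "I1 t = fst (Z t)" for t
  define I2 where "I2 t = snd (Z t)" for t
  have I1: "?int t (I1 t) {..<0}" and I2: "?int t (I2 t) {0<..}"
    and ft: "f t = exp (?g t + (I1 t + I2 t))" for t
    using spec[OF Z, of t] unfolding I1_def I2_def by blast+
  have *: "cmod (iexp (t * u) * complex_of_real (2 * (cos (h * u) - 1))) \<le> h\<^sup>2 * u\<^sup>2"
     "cmod (iexp (t * u) * complex_of_real (2 * (cos (h * u) - 1))) \<le> 4" for t u
    using norm_iexp_second_difference[of "iexp (t * u)" "h * u"] by (simp_all add: power_mult_distrib)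
  obtain B1 where B1: "\<And>(q::real \<Rightarrow> complex) I. (\<And>u. norm (q u) \<le> h\<^sup>2 * u\<^sup>2) \<Longrightarrow> (\<And>u. norm (q u) \<le> 4) \<Longrightarrow>
      has_improper_stieltjes_integral q \<Lambda> I {..<0} \<Longrightarrow> norm I \<le> B1"
    using improper_integral_bound_neg[OF L, of 4 "h\<^sup>2"] by auto
  obtain B2 where B2: "\<And>(q::real \<Rightarrow> complex) I. (\<And>u. norm (q u) \<le> h\<^sup>2 * u\<^sup>2) \<Longrightarrow> (\<And>u. norm (q u) \<le> 4) \<Longrightarrow>
      has_improper_stieltjes_integral q \<Lambda> I {0<..} \<Longrightarrow> norm I \<le> B2"
    using improper_integral_bound_pos[OF L, of 4 "h\<^sup>2"] by auto
  show ?thesis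
  proof (rule that[of "exp (\<sigma>2 * h\<^sup>2 + (B1 + B2))"])
    fix t
    let ?D1 = "I1 (t + h) + I1 (t - h) + (-2) *\<^sub>R I1 t"
    let ?D2 = "I2 (t + h) + I2 (t - h) + (-2) *\<^sub>R I2 t"
    have "cmod ?D1 \<le> B1" by (rule B1[OF * improper_second_difference[OF I1]])
    moreover have "cmod ?D2 \<le> B2" by (rule B2[OF * improper_second_difference[OF I2]])
    ultimately have "- Re (?D1 + ?D2) \<le> B1 + B2"
      using complex_Re_le_cmod[of "-(?D1 + ?D2)"] norm_triangle_ineq[of ?D1 ?D2]
      unfolding norm_minus_cancel uminus_complex.simps by linarith
    moreover have "(cmod (f t))\<^sup>2 =
      exp (\<sigma>2 * h\<^sup>2 - Re (?D1 + ?D2)) * (cmod (f (t + h)) * cmod (f (t - h)))"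
      unfolding ft norm_exp_eq_Re power2_eq_square[of "exp _"] mult_exp_exp
      by (rule arg_cong[of _ _ exp]) (simp add: field_simps power2_eq_square)
    ultimately show "(cmod (f t))\<^sup>2 \<le>
        exp (\<sigma>2 * h\<^sup>2 + (B1 + B2)) * (cmod (f (t + h)) * cmod (f (t - h)))"
      by (auto intro!: mult_right_mono)
  qed
qed

section \<open>Discrete characteristic functions\<close>

lemma norm_geometric_sum_le:
  fixes z :: complex
  assumes "norm z = 1" "z \<noteq> 1"
  shows "norm (\<Sum>j<n. z ^ j) \<le> 2 / norm (1 - z)"
proof -
  have "norm (\<Sum>j<n. z ^ j) = norm (1 - z ^ n) / norm (1 - z)"
    using assms by (simp add: sum_gp_strict norm_divide)
  also have "norm (1 - z ^ n) \<le> 2"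
    using norm_triangle_ineq4[of 1 "z ^ n"] assms by (simp add: norm_power)
  finally show ?thesis by (simp add: divide_right_mono)
qed

lemma iexp_ne_1:
  fixes y :: real
  assumes "y \<noteq> 0" "\<bar>y\<bar> \<le> 1"
  shows "iexp y \<noteq> 1"
proof
  assume "iexp y = 1"
  then have "sin y = 0" using Im_exp[of "\<i> * complex_of_real y"] by simp
  moreover have "sin \<bar>y\<bar> > 0"
    using assms pi_gt3 by (intro sin_gt_zero) auto
  ultimately show False by (cases "y \<ge> 0") auto
qed

lemma weighted_iexp_abs_summable:
  fixes w x :: "'a \<Rightarrow> real"
  assumes "w summable_on A" "\<And>k. k \<in> A \<Longrightarrow> w k \<ge> 0"
  shows "(\<lambda>k. norm (complex_of_real (w k) * iexp (t * x k))) summable_on A"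
proof -
  have "(\<lambda>k. norm (complex_of_real (w k) * iexp (t * x k))) summable_on A \<longleftrightarrow> w summable_on A"
    by (rule summable_on_cong) (use assms in \<open>simp add: norm_mult\<close>)
  then show ?thesis using assms by simp
qed

text \<open>A weak form of almost periodicity: a discrete characteristic function is not uniformly small on
  all translates of a suitable finite set. Multiplying by \<open>exp (-i j \<theta> x\<^sub>0)\<close>, where \<open>x\<^sub>0\<close> denotes \<open>x k0\<close>,
  and averaging over the points \<open>t + j \<theta>\<close> isolates the term of index \<open>k0\<close>.\<close>

lemma discrete_char_large_on_finite_translates:
  fixes w x :: "'a \<Rightarrow> real"
  assumes inj: "inj_on x A" and nonneg: "\<And>k. k \<in> A \<Longrightarrow> w k \<ge> 0"
    and sum: "w summable_on A" and k0: "k0 \<in> A" "w k0 > 0"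
  obtains R where "finite R"
    "\<And>t. \<exists>r\<in>R. w k0 / 4 \<le> cmod (\<Sum>\<^sub>\<infinity>k\<in>A. complex_of_real (w k) * iexp ((t + r) * x k))"
proof -
  let ?e = "\<lambda>t k. complex_of_real (w k) * iexp (t * x k)"
  let ?f = "\<lambda>t. \<Sum>\<^sub>\<infinity>k\<in>A. ?e t k"
  obtain B0 where B0: "finite B0" "B0 \<subseteq> A" "dist (sum w B0) (infsum w A) \<le> w k0 / 4"
    using infsum_finite_approximation[OF sum, of "w k0 / 4"] k0 by auto
  \<comment> \<open>Beyond \<open>B\<close> the series contributes at most \<open>w k0 / 4\<close>, uniformly in \<open>t\<close>.\<close>
  define B where "B = insert k0 B0"
  have B: "finite B" "B \<subseteq> A" "k0 \<in> B" using B0 k0 by (auto simp: B_def)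
  have split: "infsum g A = sum g B + infsum g (A - B)" if "g summable_on A" for g :: "'a \<Rightarrow> 'b::banach"
  proof -
    have "infsum g (B \<union> (A - B)) = infsum g B + infsum g (A - B)"
      using that B by (intro infsum_Un_disjoint) (auto intro: summable_on_cofin_subset)
    moreover have "B \<union> (A - B) = A" using B by auto
    ultimately show ?thesis using B by simp
  qed
  have "sum w B0 \<le> sum w B"
    using B B0 nonneg by (intro sum_mono2) (auto simp: B_def)
  then have tail: "infsum w (A - B) \<le> w k0 / 4"
    using split[OF sum] B0(3) unfolding dist_real_def by linarith
  have approx: "cmod (?f t - sum (?e t) B) \<le> w k0 / 4" for t
  proof -
    have s: "(\<lambda>k. norm (?e t k)) summable_on A"
      by (rule weighted_iexp_abs_summable[OF sum nonneg])
    have "?f t - sum (?e t) B = infsum (?e t) (A - B)"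
      using split[OF abs_summable_summable[OF s]] by simp
    also have "cmod \<dots> \<le> (\<Sum>\<^sub>\<infinity>k\<in>A - B. norm (?e t k))"
      by (rule norm_infsum_bound) (use s B in \<open>auto intro: summable_on_cofin_subset\<close>)
    also have "\<dots> = infsum w (A - B)"
      by (rule infsum_cong) (use nonneg in \<open>auto simp: norm_mult\<close>)
    finally show ?thesis using tail by simp
  qed
  \<comment> \<open>The step is so small that all phases \<open>\<theta> (x k - x k0)\<close> with \<open>k \<in> B\<close>, \<open>k \<noteq> k0\<close> are nonzero
     and at most \<open>1\<close> in absolute value, so that the geometric sums over them stay bounded.\<close>
  define T where "T = (\<Sum>k\<in>B. \<bar>x k - x k0\<bar>)"
  define \<theta> where "\<theta> = 1 / (1 + T)"
  have S0: "T \<ge> 0" by (simp add: T_def sum_nonneg)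
  have \<theta>: "\<theta> > 0" using S0 by (simp add: \<theta>_def)
  define z where "z k = iexp (\<theta> * (x k - x k0))" for k
  have zne: "z k \<noteq> 1" if "k \<in> B - {k0}" for k
    unfolding z_def
  proof (rule iexp_ne_1)
    show "\<theta> * (x k - x k0) \<noteq> 0"
      using \<theta> inj_onD[OF inj, of k k0] that B k0 by auto
    have "\<bar>x k - x k0\<bar> \<le> T"
      unfolding T_def using that B by (intro member_le_sum) auto
    then show "\<bar>\<theta> * (x k - x k0)\<bar> \<le> 1"
      using S0 by (simp add: \<theta>_def abs_mult)
  qed
  have zk0: "z k0 = 1" by (simp add: z_def)
  \<comment> \<open>A bound, independent of \<open>N\<close> and \<open>t\<close>, for the sum of all terms in \<open>B\<close> other than \<open>k0\<close>.\<close>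
  define Q where "Q = (\<Sum>k\<in>B - {k0}. w k * (2 / norm (1 - z k)))"
  obtain N :: nat where N: "real N > 2 * Q / w k0" using reals_Archimedean2 by blast
  have "Q \<ge> 0" unfolding Q_def using nonneg B by (intro sum_nonneg mult_nonneg_nonneg) auto
  then have N0: "N > 0" using N k0 by (cases N) (auto simp: field_simps)
  show ?thesis
  proof (rule that[of "(\<lambda>j. real j * \<theta>) ` {..<N}"])
    fix t
    show "\<exists>r\<in>(\<lambda>j. real j * \<theta>) ` {..<N}. w k0 / 4 \<le> cmod (?f (t + r))"
    proof (rule ccontr)
      assume "\<not> ?thesis"
      then have small: "cmod (?f (t + real j * \<theta>)) < w k0 / 4" if "j < N" for j
        using that by force
      let ?c = "\<lambda>j. iexp (- (real j * \<theta> * x k0))"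
      have eq: "(\<Sum>j<N. ?c j * sum (?e (t + real j * \<theta>)) B)
          = (\<Sum>k\<in>B. ?e t k * (\<Sum>j<N. z k ^ j))"
      proof -
        have "?c j * ?e (t + real j * \<theta>) k = ?e t k * z k ^ j" for j k
        proof -
          have "z k ^ j = iexp (real j * (\<theta> * (x k - x k0)))"
            unfolding z_def exp_of_nat_mult[symmetric] by (simp add: algebra_simps)
          then have "?c j * iexp ((t + real j * \<theta>) * x k) = iexp (t * x k) * z k ^ j"
            by (simp only: mult_exp_exp) (rule arg_cong[of _ _ exp], simp add: algebra_simps)
          then show ?thesis
            by (simp only: mult.left_commute[of _ "complex_of_real (w k)"] mult.assoc)
        qed
        then have "(\<Sum>j<N. ?c j * sum (?e (t + real j * \<theta>)) B) = (\<Sum>j<N. \<Sum>k\<in>B. ?e t k * z k ^ j)"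
          by (simp only: sum_distrib_left)
        also have "\<dots> = (\<Sum>k\<in>B. \<Sum>j<N. ?e t k * z k ^ j)" by (rule sum.swap)
        finally show ?thesis by (simp only: sum_distrib_left)
      qed
      have "cmod (\<Sum>j<N. ?c j * sum (?e (t + real j * \<theta>)) B) \<le> (\<Sum>j<N. w k0 / 2)"
      proof (rule sum_norm_le)
        fix j assume "j \<in> {..<N}"
        then have "cmod (?f (t + real j * \<theta>)) < w k0 / 4" using small by simp
        then have "cmod (sum (?e (t + real j * \<theta>)) B) \<le> w k0 / 2"
          using approx[of "t + real j * \<theta>"]
            norm_triangle_ineq4[of "?f (t + real j * \<theta>)" "?f (t + real j * \<theta>) - sum (?e (t + real j * \<theta>)) B"]
          by simp
        then show "cmod (?c j * sum (?e (t + real j * \<theta>)) B) \<le> w k0 / 2"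
          by (simp only: norm_mult norm_exp_i_times mult_1)
      qed
      then have up: "cmod (\<Sum>k\<in>B. ?e t k * (\<Sum>j<N. z k ^ j)) \<le> N * w k0 / 2"
        unfolding eq by simp
      have main: "(\<Sum>k\<in>B. ?e t k * (\<Sum>j<N. z k ^ j))
          = ?e t k0 * of_nat N + (\<Sum>k\<in>B - {k0}. ?e t k * (\<Sum>j<N. z k ^ j))"
        using B by (simp add: sum.remove[of B k0] zk0)
      have rest: "cmod (\<Sum>k\<in>B - {k0}. ?e t k * (\<Sum>j<N. z k ^ j)) \<le> Q"
        unfolding Q_def
      proof (rule sum_norm_le)
        fix k assume k: "k \<in> B - {k0}"
        have w: "0 \<le> w k" using nonneg k B by auto
        from k have g: "cmod (\<Sum>j<N. z k ^ j) \<le> 2 / norm (1 - z k)"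
          by (intro norm_geometric_sum_le zne) (simp_all add: z_def)
        show "cmod (?e t k * (\<Sum>j<N. z k ^ j)) \<le> w k * (2 / norm (1 - z k))"
          using mult_left_mono[OF g w] w by (simp add: norm_mult)
      qed
      have lead: "cmod (?e t k0 * of_nat N) = w k0 * N" using k0 by (simp add: norm_mult)
      have "cmod (?e t k0 * of_nat N) - cmod (\<Sum>k\<in>B - {k0}. ?e t k * (\<Sum>j<N. z k ^ j)) \<le> N * w k0 / 2"
        using norm_diff_ineq up unfolding main by (rule order_trans)
      then have "w k0 * N - Q \<le> N * w k0 / 2"
        unfolding lead using rest by linarith
      then show False using N k0 by (simp add: field_simps)
    qed
  qed simp
qed

text \<open>The measure with the given distribution function is the image under \<open>x\<close> of the probability
  mass function \<open>w\<close>, since distribution functions determine measures.\<close>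

lemma char_discrete:
  fixes w x :: "'a \<Rightarrow> real"
  assumes nonneg: "\<And>k. k \<in> A \<Longrightarrow> w k \<ge> 0" and sum: "(w has_sum 1) A"
    and M: "real_distribution M"
    and cdf: "\<And>y. cdf M y = (\<Sum>\<^sub>\<infinity>k\<in>{k\<in>A. x k \<le> y}. w k)"
  shows "char M t = (\<Sum>\<^sub>\<infinity>k\<in>A. complex_of_real (w k) * iexp (t * x k))"
proof -
  \<comment> \<open>Extension by zero, since probability mass functions live on a whole type.\<close>
  define w' where "w' k = (if k \<in> A then w k else 0)" for k
  have w'0: "w' k \<ge> 0" for k using nonneg by (simp add: w'_def)
  have "(w' has_sum 1) UNIV"
    using sum by (rule has_sum_cong_neutral[THEN iffD1, rotated -1]) (auto simp: w'_def)
  then have inf1: "infsum w' UNIV = 1" and "w' summable_on UNIV"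
    by (auto simp: infsumI has_sum_imp_summable)
  then have "Infinite_Sum.abs_summable_on w' UNIV" using w'0 by simp
  then have abs: "Infinite_Set_Sum.abs_summable_on w' UNIV" by (simp only: abs_summable_equivalent)
  have "(\<integral>\<^sup>+k. ennreal (w' k) \<partial>count_space UNIV) = ennreal (infsetsum w' UNIV)"
    using nn_integral_conv_infsetsum[OF abs] w'0 by simp
  also have "\<dots> = 1" using infsetsum_infsum[OF abs] inf1 by simp
  finally have pr: "(\<integral>\<^sup>+k. ennreal (w' k) \<partial>count_space UNIV) = 1" .
  define P where "P = embed_pmf w'"
  have pmf: "pmf P k = w' k" for k unfolding P_def by (rule pmf_embed_pmf[OF w'0 pr])
  define N where "N = distr (measure_pmf P) borel x"
  have N: "real_distribution N"
    unfolding N_def by (intro real_distribution.intro prob_space.prob_space_distr) 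
      (auto simp: real_distribution_axioms_def measure_pmf.prob_space_axioms)
  have "cdf N y = cdf M y" for y
  proof -
    have "cdf N y = measure (measure_pmf P) {k. x k \<le> y}"
      by (simp add: cdf_def N_def measure_distr vimage_def)
    also have "\<dots> = infsetsum w' {k. x k \<le> y}"
      by (simp add: measure_pmf_conv_infsetsum pmf cong: infsetsum_cong)
    also have "\<dots> = infsum w' {k. x k \<le> y}"
      by (rule infsetsum_infsum) (rule abs_summable_on_subset[OF abs], simp)
    also have "\<dots> = (\<Sum>\<^sub>\<infinity>k\<in>{k\<in>A. x k \<le> y}. w k)"
      by (rule infsum_cong_neutral) (auto simp: w'_def)
    finally show ?thesis by (simp add: cdf)
  qed
  then have "M = N" by (intro cdf_unique[OF M N]) auto
  then have "char M t = measure_pmf.expectation P (\<lambda>k. iexp (t * x k))"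
    by (simp add: char_def N_def integral_distr)
  also have "\<dots> = (\<integral>k. w' k *\<^sub>R iexp (t * x k) \<partial>count_space UNIV)"
    by (simp add: measure_pmf_eq_density integral_density pmf w'0)
  also have "\<dots> = infsetsum (\<lambda>k. w' k *\<^sub>R iexp (t * x k)) UNIV"
    by (simp add: infsetsum_def)
  also have "\<dots> = infsum (\<lambda>k. w' k *\<^sub>R iexp (t * x k)) UNIV"
  proof (rule infsetsum_infsum)
    show "Infinite_Set_Sum.abs_summable_on (\<lambda>k. w' k *\<^sub>R iexp (t * x k)) UNIV"
      by (rule Infinite_Set_Sum.abs_summable_on_comparison_test[OF abs]) simp
  qed
  also have "\<dots> = (\<Sum>\<^sub>\<infinity>k\<in>A. complex_of_real (w k) * iexp (t * x k))"
    by (rule infsum_cong_neutral) (auto simp: w'_def scaleR_conv_of_real)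
  finally show ?thesis .
qed

theorem theorem2:
  fixes x :: "nat \<Rightarrow> real" and p :: "real \<Rightarrow> real"
    and F :: "real \<Rightarrow> real" and f :: "real \<Rightarrow> complex"
  assumes "inj_on x {1..}"
    and "\<And>k. k \<ge> 1 \<Longrightarrow> p (x k) \<ge> 0"
    and "((\<lambda>k. p (x k)) has_sum 1) {1..}"
    and "\<And>y. F y = (\<Sum>\<^sub>\<infinity>k\<in>{k. k \<ge> 1 \<and> x k \<le> y}. p (x k))"
    and "\<And>t. f t = (\<Sum>\<^sub>\<infinity>k\<in>{1..}. complex_of_real (p (x k)) * iexp (t * x k))"
    and "(INF t. cmod (f t)) = 0"
  shows "\<not> quasi_infinitely_divisible F"
proof
  assume "quasi_infinitely_divisible F"
  then obtain M \<gamma> \<sigma>2 \<Lambda> where M: "real_distribution M" "cdf M = F"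
    and L: "levy_spectral_function \<Lambda>"
    and rep: "\<And>t. \<exists>I. has_levy_integral (\<lambda>u. iexp (t * u) - 1 - \<i> * complex_of_real (t * sin u)) \<Lambda> I \<and>
       char M t = exp (\<i> * complex_of_real (t * \<gamma>) - complex_of_real (\<sigma>2 * t\<^sup>2 / 2) + I)"
    unfolding quasi_infinitely_divisible_def by blast
  have char: "char M t = f t" for t
    unfolding assms(5)
    by (rule char_discrete[OF _ assms(3) M(1)]) (use assms(2,4) M(2) in auto)
  note sm = has_sum_imp_summable[OF assms(3)]
  have "\<exists>k0\<ge>1. p (x k0) > 0"
  proof (rule ccontr)
    assume "\<not> ?thesis"
    then have "((\<lambda>k. p (x k)) has_sum 0) {1..}"
      using assms(2) by (intro has_sum_0) force
    then show False using has_sum_unique[OF assms(3)] by fastforce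
  qed
  then obtain k0 where k0: "k0 \<ge> 1" "p (x k0) > 0" by blast
  define \<epsilon> where "\<epsilon> = p (x k0) / 4"
  have "\<epsilon> > 0" using k0 by (simp add: \<epsilon>_def)
  obtain R where R: "finite R" "\<And>t. \<exists>r\<in>R. \<epsilon> \<le> cmod (f (t + r))"
    using discrete_char_large_on_finite_translates[OF assms(1) _ sm _ k0(2)] assms(2) k0(1)
    unfolding assms(5) \<epsilon>_def by auto
  have "\<exists>C. \<forall>t. (cmod (f t))\<^sup>2 \<le> C * (cmod (f (t + h)) * cmod (f (t - h)))" for h
    using levy_khinchine_second_difference[OF L rep, of h] unfolding char by blast
  then obtain C where C: "\<And>h t. (cmod (f t))\<^sup>2 \<le> C h * (cmod (f (t + h)) * cmod (f (t - h)))"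
    by metis
  have f1: "cmod (f t) \<le> 1" for t
    unfolding char[symmetric] by (rule real_distribution.cmod_char_le_1[OF M(1)])
  \<comment> \<open>A positive constant that serves all steps in the finite set \<open>R\<close> at once.\<close>
  define K where "K = 1 + (\<Sum>r\<in>R. \<bar>C r\<bar>)"
  have K: "K > 0" "\<And>r. r \<in> R \<Longrightarrow> C r \<le> K"
  proof -
    show "K > 0" by (simp add: K_def sum_nonneg add_pos_nonneg)
    fix r assume "r \<in> R"
    then have "\<bar>C r\<bar> \<le> (\<Sum>r\<in>R. \<bar>C r\<bar>)" using R(1) by (intro member_le_sum) auto
    then show "C r \<le> K" by (simp add: K_def)
  qed
  have "(INF t. cmod (f t)) < \<epsilon>\<^sup>2 / K" using assms(6) K(1) \<open>\<epsilon> > 0\<close> by simp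
  then obtain s where s: "cmod (f s) < \<epsilon>\<^sup>2 / K"
    by (subst (asm) cInf_less_iff) (auto intro!: bdd_belowI[of _ 0])
  obtain r where r: "r \<in> R" "\<epsilon> \<le> cmod (f (s + r))" using R(2) by blast
  have "\<epsilon>\<^sup>2 \<le> (cmod (f (s + r)))\<^sup>2" using r \<open>\<epsilon> > 0\<close> by (intro power_mono) auto
  also have "\<dots> \<le> C r * (cmod (f (s + 2 * r)) * cmod (f s))"
    using C[of "s + r" r] by (simp add: algebra_simps)
  also have "\<dots> \<le> K * (1 * cmod (f s))"
    using K r f1 by (intro mult_mono) auto
  also have "\<dots> < \<epsilon>\<^sup>2" using s K(1) by (simp add: field_simps)
  finally show False by simp
qed

end
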